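(* Consider a finite $n$-player extensive-form game with perfect recall. Suppose that for every player $i\in[n]$ the sequence of deterministic sequence-form strategies $\pi_i^{(1)},\dots,\pi_i^{(T)}\in\Pi_i$ incurs $\widetilde\Psi_i$-regret at most $\mathrm{Reg}_i^T$ under the sequence of linear utility functions $\ell_i^{(t)}:\Pi_i\ni\pi_i\mapsto u_i(\pi_i,\pi_{-i}^{(t)})$, that is, $$\max_{\phi\in\widetilde\Psi_i}\sum_{t=1}^T \ell_i^{(t)}(\phi(\pi_i^{(t)}))-\sum_{t=1}^T\ell_i^{(t)}(\pi_i^{(t)})\le \mathrm{Reg}_i^T .$$ Then the correlated distribution of play $\mu\in\Delta(\Pi)$, $\mu[\pi]=\frac1T|\{t\in\{1,\dots,T\}:\pi^{(t)}=\pi\}|$, is an $\epsilon$-EFCCE with $\epsilon=\frac1T\max_{i\in[n]}\mathrm{Reg}_i^T$, i.e. $\mathbb E_{\pi\sim\mu}[u_i(\phi(\pi_i),\pi_{-i})-u_i(\pi)]\le\epsilon$ for every $i\in[n]$ and every $\phi\in\widetilde\Psi_i$.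
   Context: **Games.** A finite extensive-form game has a rooted game tree, players $[n]$ and a chance player with fixed probabilities; $\mathcal Z$ is the set of leaves, $u_i:\mathcal Z\to[-1,1]$ the utility of player $i$, and $p_c(z)$ the product of the chance probabilities on the path to $z$. The decision nodes of player $i$ are partitioned into information sets $\mathcal J_i$; $\mathcal A_j$ is the action set at $j$; perfect recall holds. For $j,j'\in\mathcal J_i$, $j\prec j'$ if some path from the root to a node of $j'$ passes through a node of $j$ ($j \neq j'$). Sequences: $\Sigma_i=\{(j,a):j\in\mathcal J_i,a\in\mathcal A_j\}\cup\{\varnothing\}$. The parent sequence $\sigma_j\in\Sigma_i$ is the last sequence of player $i$ before reaching $j$ ($\varnothing$ if none); $\sigma_{i,z}$ is the last sequence of player $i$ before leaf $z$. For $\sigma=(j',a')$, $\sigma\succeq j$ means $j'=j$ or $j\prec j'$; $\varnothing\not\succeq j$. **Strategies.** $\mathcal Q_i=\{q\in\mathbb R^{\Sigma_i}_{\ge0}: q[\varnothing]=1,\ q[\sigma_j]=\sum_{a\in\mathcal A_j}q[(j,a)]\ \forall j\in\mathcal J_i\}$, $\Pi_i=\mathcal Q_i\cap\{0,1\}^{\Sigma_i}$. With $\Sigma_j=\{\sigma\in\Sigma_i:\sigma\succeq j\}$, $\mathcal Q_j$ is the set of $q\in\mathbb R_{\ge0}^{\Sigma_j}$ with $\sum_{a\in\mathcal A_j}q[(j,a)]=1$ and $q[\sigma_{j'}]=\sum_{a\in\mathcal A_{j'}}q[(j',a)]$ for all $j'\succ j$; $\Pi_j=\mathcal Q_j\cap\{0,1\}^{\Sigma_j}$.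 $\Pi=\Pi_1\times\dots\times\Pi_n$ and $u_i(\pi)=\sum_{z\in\mathcal Z}p_c(z)u_i(z)\prod_{k\in[n]}\pi_k[\sigma_{k,z}]$; $\pi^{(t)}=(\pi^{(t)}_1,\dots,\pi^{(t)}_n)$. **Coarse trigger deviations.** For $j\in\mathcal J_i$ and $\hat\pi_i\in\Pi_j$, the coarse trigger deviation function $\phi_{j\to\hat\pi_i}$ is the linear map $\mathbb R^{\Sigma_i}\to\mathbb R^{\Sigma_i}$ with: $\phi_{j\to\hat\pi_i}(\pi_i)=\pi_i$ for $\pi_i\in\Pi_i$ with $\pi_i[\sigma_j]=0$; and if $\pi_i[\sigma_j]=1$, then $\phi_{j\to\hat\pi_i}(\pi_i)[\sigma]=\pi_i[\sigma]$ for $\sigma\not\succeq j$ and $=\hat\pi_i[\sigma]$ for $\sigma\succeq j$. $\widetilde\Psi_i=\{\phi_{j\to\hat\pi_i}:j\in\mathcal J_i,\hat\pi_i\in\Pi_j\}$. EFCCE stands for extensive-form coarse correlated equilibrium. *)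

theory Defs
  imports
    "HOL-Probability.Probability_Mass_Function"
    "HOL-Library.Sublist"
    "HOL-Library.Disjoint_Sets"
begin

section \<open>Finite extensive-form games with perfect recall\<close>

text \<open>
  A node of the game tree is identified with the list of actions on the path from the root to it,
  so the root is \<open>[]\<close>. Players are \<open>1, \<dots>, nplayers G\<close>; \<open>turn G h = None\<close> means that chance moves
  at \<open>h\<close>. Information sets are literally sets of nodes.
\<close>

record 'a game =
  nplayers :: nat
  nodes :: "'a list set"
  turn :: "'a list \<Rightarrow> nat option"
  chance_prob :: "'a list \<Rightarrow> 'a \<Rightarrow> real"
  leaf_utility :: "nat \<Rightarrow> 'a list \<Rightarrow> real"
  infosets :: "nat \<Rightarrow> 'a list set set"

text \<open>A sequence is a pair of an information set and an action, or \<open>None\<close> for the empty sequence.\<close>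

type_synonym 'a seq = "('a list set \<times> 'a) option"

definition players :: "'a game \<Rightarrow> nat set" where
  "players G = {1..nplayers G}"

definition node_actions :: "'a game \<Rightarrow> 'a list \<Rightarrow> 'a set" where
  "node_actions G h = {a. h @ [a] \<in> nodes G}"

definition leaves :: "'a game \<Rightarrow> 'a list set" where
  "leaves G = {h \<in> nodes G. node_actions G h = {}}"

definition chance_nodes :: "'a game \<Rightarrow> 'a list set" where
  "chance_nodes G = {h \<in> nodes G - leaves G. turn G h = None}"

definition decision_nodes :: "'a game \<Rightarrow> nat \<Rightarrow> 'a list set" where
  "decision_nodes G i = {h \<in> nodes G - leaves G. turn G h = Some i}"

text \<open>In a well-formed game all nodes of an information set have the same actions.\<close>

definition infoset_actions :: "'a game \<Rightarrow> 'a list set \<Rightarrow> 'a set" where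
  "infoset_actions G j = (\<Union>h\<in>j. node_actions G h)"

definition infoset_of :: "'a game \<Rightarrow> nat \<Rightarrow> 'a list \<Rightarrow> 'a list set" where
  "infoset_of G i h = (THE j. j \<in> infosets G i \<and> h \<in> j)"

text \<open>
  The information sets visited and actions taken by player \<open>i\<close> strictly before \<open>h\<close>; the prefixes
  \<open>take m h\<close> with \<open>m < length h\<close> are the proper ancestors of \<open>h\<close>.
\<close>

definition own_history :: "'a game \<Rightarrow> nat \<Rightarrow> 'a list \<Rightarrow> ('a list set \<times> 'a) list" where
  "own_history G i h =
     map (\<lambda>m. (infoset_of G i (take m h), h ! m))
       (filter (\<lambda>m. take m h \<in> decision_nodes G i) [0..<length h])"

definition last_seq :: "'a game \<Rightarrow> nat \<Rightarrow> 'a list \<Rightarrow> 'a seq" where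
  "last_seq G i h =
     (if own_history G i h = [] then None else Some (last (own_history G i h)))"

definition perfect_recall :: "'a game \<Rightarrow> bool" where
  "perfect_recall G \<longleftrightarrow>
     (\<forall>i\<in>players G. \<forall>j\<in>infosets G i. \<forall>h\<in>j. \<forall>h'\<in>j. own_history G i h = own_history G i h')"

definition extensive_form_game :: "'a game \<Rightarrow> bool" where
  "extensive_form_game G \<longleftrightarrow>
     nplayers G \<ge> 1 \<and>
     finite (nodes G) \<and> [] \<in> nodes G \<and>
     (\<forall>h a. h @ [a] \<in> nodes G \<longrightarrow> h \<in> nodes G) \<and>
     (\<forall>h\<in>nodes G - leaves G. \<forall>i. turn G h = Some i \<longrightarrow> i \<in> players G) \<and>
     (\<forall>h\<in>chance_nodes G.
        (\<forall>a\<in>node_actions G h. chance_prob G h a \<ge> 0) \<and>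
        (\<Sum>a\<in>node_actions G h. chance_prob G h a) = 1) \<and>
     (\<forall>i\<in>players G. \<forall>z\<in>leaves G. leaf_utility G i z \<in> {-1..1}) \<and>
     (\<forall>i\<in>players G.
        partition_on (decision_nodes G i) (infosets G i) \<and>
        (\<forall>j\<in>infosets G i. \<forall>h\<in>j. \<forall>h'\<in>j. node_actions G h = node_actions G h'))"

definition reach_chance :: "'a game \<Rightarrow> 'a list \<Rightarrow> real" where
  "reach_chance G z =
     (\<Prod>m\<in>{m. m < length z \<and> take m z \<in> chance_nodes G}. chance_prob G (take m z) (z ! m))"

text \<open>\<open>infoset_less j j'\<close> is \<open>j \<prec> j'\<close>.\<close>

definition infoset_less :: "'a list set \<Rightarrow> 'a list set \<Rightarrow> bool" where
  "infoset_less j j' \<longleftrightarrow> j \<noteq> j' \<and> (\<exists>h\<in>j. \<exists>h'\<in>j'. prefix h h')"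

definition sequences :: "'a game \<Rightarrow> nat \<Rightarrow> 'a seq set" where
  "sequences G i =
     {Some (j, a) | j a. j \<in> infosets G i \<and> a \<in> infoset_actions G j} \<union> {None}"

text \<open>Under perfect recall \<open>last_seq G i\<close> is constant on \<open>j\<close>.\<close>

definition parent_seq :: "'a game \<Rightarrow> nat \<Rightarrow> 'a list set \<Rightarrow> 'a seq" where
  "parent_seq G i j = (THE \<sigma>. \<forall>h\<in>j. last_seq G i h = \<sigma>)"

text \<open>\<open>seq_geq \<sigma> j\<close> is \<open>\<sigma> \<succeq> j\<close>.\<close>

definition seq_geq :: "'a seq \<Rightarrow> 'a list set \<Rightarrow> bool" where
  "seq_geq \<sigma> j \<longleftrightarrow> (\<exists>j' a'. \<sigma> = Some (j', a') \<and> (j' = j \<or> infoset_less j j'))"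

definition sequences_from :: "'a game \<Rightarrow> nat \<Rightarrow> 'a list set \<Rightarrow> 'a seq set" where
  "sequences_from G i j = {\<sigma> \<in> sequences G i. seq_geq \<sigma> j}"


section \<open>Sequence-form strategies\<close>

text \<open>
  The coordinate space of real vectors indexed by \<open>S\<close>, as functions that vanish off \<open>S\<close>.
\<close>

definition vectors :: "'s set \<Rightarrow> ('s \<Rightarrow> real) set" where
  "vectors S = {x. \<forall>s. s \<notin> S \<longrightarrow> x s = 0}"

definition linear_on_vectors :: "'s set \<Rightarrow> (('s \<Rightarrow> real) \<Rightarrow> ('s \<Rightarrow> real)) \<Rightarrow> bool" where
  "linear_on_vectors S f \<longleftrightarrow>
     f ` vectors S \<subseteq> vectors S \<and>
     (\<forall>x\<in>vectors S. \<forall>y\<in>vectors S. f (\<lambda>s. x s + y s) = (\<lambda>s. f x s + f y s)) \<and>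
     (\<forall>c. \<forall>x\<in>vectors S. f (\<lambda>s. c * x s) = (\<lambda>s. c * f x s))"

definition strategies :: "'a game \<Rightarrow> nat \<Rightarrow> ('a seq \<Rightarrow> real) set" where
  "strategies G i =
     {q \<in> vectors (sequences G i).
        (\<forall>\<sigma>\<in>sequences G i. q \<sigma> \<ge> 0) \<and> q None = 1 \<and>
        (\<forall>j\<in>infosets G i. q (parent_seq G i j) = (\<Sum>a\<in>infoset_actions G j. q (Some (j, a))))}"

definition pure_strategies :: "'a game \<Rightarrow> nat \<Rightarrow> ('a seq \<Rightarrow> real) set" where
  "pure_strategies G i = {q \<in> strategies G i. \<forall>\<sigma>\<in>sequences G i. q \<sigma> \<in> {0, 1}}"

definition strategies_from :: "'a game \<Rightarrow> nat \<Rightarrow> 'a list set \<Rightarrow> ('a seq \<Rightarrow> real) set" where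
  "strategies_from G i j =
     {q \<in> vectors (sequences_from G i j).
        (\<forall>\<sigma>\<in>sequences_from G i j. q \<sigma> \<ge> 0) \<and>
        (\<Sum>a\<in>infoset_actions G j. q (Some (j, a))) = 1 \<and>
        (\<forall>j'\<in>infosets G i. infoset_less j j' \<longrightarrow>
           q (parent_seq G i j') = (\<Sum>a\<in>infoset_actions G j'. q (Some (j', a))))}"

definition pure_strategies_from :: "'a game \<Rightarrow> nat \<Rightarrow> 'a list set \<Rightarrow> ('a seq \<Rightarrow> real) set" where
  "pure_strategies_from G i j =
     {q \<in> strategies_from G i j. \<forall>\<sigma>\<in>sequences_from G i j. q \<sigma> \<in> {0, 1}}"

text \<open>Profiles are extensional, so that equality of profiles is equality on the players.\<close>

definition pure_profiles :: "'a game \<Rightarrow> (nat \<Rightarrow> 'a seq \<Rightarrow> real) set" where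
  "pure_profiles G = (\<Pi>\<^sub>E i\<in>players G. pure_strategies G i)"

definition utility :: "'a game \<Rightarrow> nat \<Rightarrow> (nat \<Rightarrow> 'a seq \<Rightarrow> real) \<Rightarrow> real" where
  "utility G i p =
     (\<Sum>z\<in>leaves G. reach_chance G z * leaf_utility G i z *
        (\<Prod>k\<in>players G. p k (last_seq G k z)))"


section \<open>Coarse trigger deviations, regret and EFCCE\<close>

text \<open>
  The conditions determine the linear map on the pure strategies (hence on their span), but not on
  all vectors, so being a coarse trigger deviation function is a predicate. Such a map always
  exists, see \<open>coarse_trigger_deviation_exists\<close> below.
\<close>

definition coarse_trigger_deviation ::
    "'a game \<Rightarrow> nat \<Rightarrow> 'a list set \<Rightarrow> ('a seq \<Rightarrow> real) \<Rightarrow>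
     (('a seq \<Rightarrow> real) \<Rightarrow> ('a seq \<Rightarrow> real)) \<Rightarrow> bool" where
  "coarse_trigger_deviation G i j q \<phi> \<longleftrightarrow>
     linear_on_vectors (sequences G i) \<phi> \<and>
     (\<forall>p\<in>pure_strategies G i.
        (p (parent_seq G i j) = 0 \<longrightarrow> \<phi> p = p) \<and>
        (p (parent_seq G i j) = 1 \<longrightarrow>
           (\<forall>\<sigma>\<in>sequences G i. \<phi> p \<sigma> = (if seq_geq \<sigma> j then q \<sigma> else p \<sigma>))))"

definition coarse_trigger_deviations ::
    "'a game \<Rightarrow> nat \<Rightarrow> (('a seq \<Rightarrow> real) \<Rightarrow> ('a seq \<Rightarrow> real)) set" where
  "coarse_trigger_deviations G i =
     {\<phi>. \<exists>j\<in>infosets G i. \<exists>q\<in>pure_strategies_from G i j. coarse_trigger_deviation G i j q \<phi>}"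

text \<open>
  The regret of a sequence of strategies \<open>x 1, \<dots>, x T\<close> with respect to a nonempty set \<open>\<Phi>\<close> of
  deviations and utility functions \<open>l 1, \<dots>, l T\<close>. The maximum is over the set of attained
  values; for coarse trigger deviations it is finite although the set of linear maps need not be,
  because maps with the same \<open>j\<close> and \<open>q\<close> agree on the pure strategies.
\<close>

definition deviation_regret ::
    "('s \<Rightarrow> 's) set \<Rightarrow> nat \<Rightarrow> (nat \<Rightarrow> 's \<Rightarrow> real) \<Rightarrow> (nat \<Rightarrow> 's) \<Rightarrow> real" where
  "deviation_regret \<Phi> T l x =
     Max ((\<lambda>\<phi>. \<Sum>t=1..T. l t (\<phi> (x t))) ` \<Phi>) - (\<Sum>t=1..T. l t (x t))"

definition distribution_of_play :: "nat \<Rightarrow> (nat \<Rightarrow> 'p) \<Rightarrow> 'p pmf" where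
  "distribution_of_play T \<pi> = embed_pmf (\<lambda>p. 1 / real T * real (card {t \<in> {1..T}. \<pi> t = p}))"

definition approx_EFCCE :: "'a game \<Rightarrow> real \<Rightarrow> (nat \<Rightarrow> 'a seq \<Rightarrow> real) pmf \<Rightarrow> bool" where
  "approx_EFCCE G \<epsilon> \<mu> \<longleftrightarrow>
     set_pmf \<mu> \<subseteq> pure_profiles G \<and>
     (\<forall>i\<in>players G. \<forall>\<phi>\<in>coarse_trigger_deviations G i.
        measure_pmf.expectation \<mu> (\<lambda>\<pi>. utility G i (\<pi>(i := \<phi> (\<pi> i))) - utility G i \<pi>) \<le> \<epsilon>)"


section \<open>Well-definedness\<close>

lemma pmf_distribution_of_play:
  assumes "T \<ge> 1"
  shows "pmf (distribution_of_play T \<pi>) p = 1 / real T * real (card {t \<in> {1..T}. \<pi> t = p})"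
proof -
  have pmf_eq: "pmf (map_pmf \<pi> (pmf_of_set {1..T})) p =
      1 / real T * real (card {t \<in> {1..T}. \<pi> t = p})" for p
  proof -
    have "{1..T} \<inter> \<pi> -` {p} = {t \<in> {1..T}. \<pi> t = p}"
      by blast
    moreover have "finite {1..T}" "{1..T} \<noteq> {}"
      using assms by simp_all
    ultimately show ?thesis
      by (simp add: pmf_map measure_pmf_of_set)
  qed
  have "distribution_of_play T \<pi> = map_pmf \<pi> (pmf_of_set {1..T})"
    unfolding distribution_of_play_def pmf_eq[symmetric]
    by (rule type_definition.Rep_inverse[OF td_pmf_embed_pmf])
  then show ?thesis
    by (simp only: pmf_eq)
qed

lemma nodes_prefix:
  assumes "extensive_form_game G" "h \<in> nodes G" "prefix h' h"
  shows "h' \<in> nodes G"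
proof -
  have closed: "\<And>h a. h @ [a] \<in> nodes G \<Longrightarrow> h \<in> nodes G"
    using assms(1) unfolding extensive_form_game_def by (elim conjE) blast
  obtain k where "h = h' @ k"
    using assms(3) by (auto simp: prefix_def)
  with assms(2) show ?thesis
  proof (induction k arbitrary: h rule: rev_induct)
    case (snoc a k)
    from snoc.prems have "(h' @ k) @ [a] \<in> nodes G"
      by simp
    then have "h' @ k \<in> nodes G"
      by (rule closed)
    then show ?case
      using snoc.IH by blast
  qed simp
qed

lemma infosets_partition:
  assumes "extensive_form_game G" "i \<in> players G"
  shows "partition_on (decision_nodes G i) (infosets G i)"
  using assms by (simp add: extensive_form_game_def)

lemma infoset_unique:
  assumes "extensive_form_game G" "i \<in> players G"
    and "j \<in> infosets G i" "j' \<in> infosets G i" "h \<in> j" "h \<in> j'"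
  shows "j = j'"
  using partition_onD2[OF infosets_partition[OF assms(1,2)]] assms(3-) by (auto simp: disjoint_def)

lemma infoset_of_mem:
  assumes "extensive_form_game G" "i \<in> players G" "h \<in> decision_nodes G i"
  shows "infoset_of G i h \<in> infosets G i" "h \<in> infoset_of G i h"
proof -
  obtain j where j: "j \<in> infosets G i" "h \<in> j"
    using partition_onD1[OF infosets_partition[OF assms(1,2)]] assms(3) by blast
  then have "infoset_of G i h = j"
    unfolding infoset_of_def
    using infoset_unique[OF assms(1,2)] by (intro the_equality) metis+
  with j show "infoset_of G i h \<in> infosets G i" "h \<in> infoset_of G i h"
    by auto
qed

lemma parent_seq_eq:
  assumes "extensive_form_game G" "perfect_recall G" "i \<in> players G" "j \<in> infosets G i" "h \<in> j"
  shows "parent_seq G i j = last_seq G i h"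
proof -
  have "\<forall>h'\<in>j. last_seq G i h' = last_seq G i h"
  proof
    fix h'
    assume "h' \<in> j"
    from assms(2)[unfolded perfect_recall_def, rule_format, OF assms(3,4) this assms(5)]
    have "own_history G i h' = own_history G i h" .
    then show "last_seq G i h' = last_seq G i h"
      by (simp add: last_seq_def)
  qed
  then show ?thesis
    unfolding parent_seq_def
    by (rule the_equality) (drule bspec[OF _ assms(5)], erule sym)
qed

lemma finite_infoset_actions:
  assumes "extensive_form_game G"
  shows "finite (infoset_actions G j)"
proof -
  have "infoset_actions G j \<subseteq> last ` nodes G"
  proof
    fix a
    assume "a \<in> infoset_actions G j"
    then obtain h where "h @ [a] \<in> nodes G"
      by (auto simp: infoset_actions_def node_actions_def)
    then show "a \<in> last ` nodes G"
      by (rule rev_image_eqI) simp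
  qed
  moreover have "finite (nodes G)"
    using assms by (simp add: extensive_form_game_def)
  ultimately show ?thesis
    using finite_surj by blast
qed

lemma strategy_zero_child:
  assumes "extensive_form_game G" "p \<in> strategies G i" "j \<in> infosets G i"
    and "a \<in> infoset_actions G j" "p (parent_seq G i j) = 0"
  shows "p (Some (j, a)) = 0"
proof -
  have "\<forall>j\<in>infosets G i. p (parent_seq G i j) = (\<Sum>a\<in>infoset_actions G j. p (Some (j, a)))"
    using assms(2) unfolding strategies_def by blast
  from bspec[OF this assms(3)] assms(5)
  have sum0: "(\<Sum>a\<in>infoset_actions G j. p (Some (j, a))) = 0"
    by (rule trans[OF sym])
  have "\<forall>\<sigma>\<in>sequences G i. p \<sigma> \<ge> 0"
    using assms(2) unfolding strategies_def by blast
  then have "p (Some (j, a)) \<ge> 0" if "a \<in> infoset_actions G j" for a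
    using assms(3) that by (auto simp: sequences_def)
  then have "\<forall>a\<in>infoset_actions G j. p (Some (j, a)) = 0"
    using sum0 by (simp only: sum_nonneg_eq_0_iff[OF finite_infoset_actions[OF assms(1)]])
  then show ?thesis
    using assms(4) by (rule bspec)
qed

lemma sorted_le_last:
  fixes xs :: "nat list"
  assumes "sorted xs" "x \<in> set xs"
  shows "x \<le> last xs"
  using assms by (induction xs) auto

lemma strategy_zero_below:
  assumes G: "extensive_form_game G" "perfect_recall G" and i: "i \<in> players G"
    and p: "p \<in> strategies G i" and j: "j \<in> infosets G i" "h \<in> j"
    and zero: "p (parent_seq G i j) = 0"
    and j': "j' \<in> infosets G i" "h' \<in> j'" and pre: "prefix h h'"
  shows "p (parent_seq G i j') = 0"
  using j' pre
proof (induction "length h'" arbitrary: h' j' rule: less_induct)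
  case less
  have dec: "\<And>j h. j \<in> infosets G i \<Longrightarrow> h \<in> j \<Longrightarrow> h \<in> decision_nodes G i"
    using partition_onD1[OF infosets_partition[OF G(1) i]] by blast
  show ?case
  proof (cases "h = h'")
    case True
    then have "j = j'"
      using infoset_unique[OF G(1) i j(1) less.prems(1) j(2)] less.prems(2) by simp
    then show ?thesis
      using zero by simp
  next
    case False
    let ?ms = "filter (\<lambda>m. take m h' \<in> decision_nodes G i) [0..<length h']"
    have len: "length h < length h'" and tk: "take (length h) h' = h"
      using False less.prems(3) by (auto simp: prefix_def)
    have mem: "length h \<in> set ?ms"
      using len tk dec[OF j] by auto
    then have ne: "?ms \<noteq> []"
      by (metis empty_iff list.set(1))
    define m where "m = last ?ms"
    have m: "m \<in> set ?ms"
      using ne unfolding m_def by (rule last_in_set)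
    have "sorted ?ms"
      by (simp add: sorted_wrt_filter)
    then have le: "length h \<le> m"
      unfolding m_def using mem by (rule sorted_le_last)
    let ?j = "infoset_of G i (take m h')"
    have d: "take m h' \<in> decision_nodes G i" and mlt: "m < length h'"
      using m by auto
    have "take (length h) (take m h') = h"
      using tk le by (simp add: min_absorb1)
    then have pre: "prefix h (take m h')"
      using take_is_prefix[of "length h" "take m h'"] by simp
    have "length (take m h') < length h'"
      using mlt by simp
    then have z: "p (parent_seq G i ?j) = 0"
      using infoset_of_mem[OF G(1) i d] pre by (rule less.hyps)
    have "h' \<in> nodes G"
      using dec[OF less.prems(1,2)] by (simp add: decision_nodes_def)
    then have "take (Suc m) h' \<in> nodes G"
      using nodes_prefix[OF G(1)] take_is_prefix by blast
    then have "take m h' @ [h' ! m] \<in> nodes G"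
      by (simp only: take_Suc_conv_app_nth[OF mlt])
    then have "h' ! m \<in> infoset_actions G ?j"
      using infoset_of_mem(2)[OF G(1) i d] by (auto simp: infoset_actions_def node_actions_def)
    then have "p (Some (?j, h' ! m)) = 0"
      using strategy_zero_child[OF G(1) p infoset_of_mem(1)[OF G(1) i d] _ z] by blast
    moreover have "parent_seq G i j' = Some (?j, h' ! m)"
      unfolding parent_seq_eq[OF G i less.prems(1,2)] last_seq_def own_history_def m_def
      using ne by (simp add: last_map)
    ultimately show ?thesis
      by simp
  qed
qed

lemma coarse_trigger_deviation_exists:
  assumes G: "extensive_form_game G" "perfect_recall G" and i: "i \<in> players G"
    and j: "j \<in> infosets G i"
  shows "\<exists>\<phi>. coarse_trigger_deviation G i j q \<phi>"
proof -
  define \<phi> where "\<phi> = (\<lambda>x \<sigma>. if \<sigma> \<notin> sequences G i then 0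
      else if seq_geq \<sigma> j then x (parent_seq G i j) * q \<sigma> else x \<sigma> :: real)"
  have "linear_on_vectors (sequences G i) \<phi>"
    by (auto simp: linear_on_vectors_def vectors_def \<phi>_def fun_eq_iff algebra_simps)
  moreover have "\<phi> p = p" if p: "p \<in> pure_strategies G i" and z: "p (parent_seq G i j) = 0" for p
  proof
    fix \<sigma>
    have ps: "p \<in> strategies G i"
      using p by (simp add: pure_strategies_def)
    show "\<phi> p \<sigma> = p \<sigma>"
    proof (cases "\<sigma> \<in> sequences G i")
      case False
      then show ?thesis
        using ps by (simp add: \<phi>_def strategies_def vectors_def)
    next
      case True
      have "p \<sigma> = 0" if geq: "seq_geq \<sigma> j"
      proof -
        obtain j' a where s: "\<sigma> = Some (j', a)" "j' = j \<or> infoset_less j j'"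
          using geq by (auto simp: seq_geq_def)
        then have s': "j' \<in> infosets G i" "a \<in> infoset_actions G j'"
          using True by (auto simp: sequences_def)
        have "p (parent_seq G i j') = 0"
          using s(2) z strategy_zero_below[OF G i ps j _ z s'(1)]
          by (auto simp: infoset_less_def)
        then show ?thesis
          using strategy_zero_child[OF G(1) ps s'] s(1) by simp
      qed
      then show ?thesis
        using True z by (simp add: \<phi>_def)
    qed
  qed
  ultimately have "coarse_trigger_deviation G i j q \<phi>"
    unfolding coarse_trigger_deviation_def by (simp add: \<phi>_def)
  then show ?thesis
    by blast
qed

end

(*
  The expectation under the empirical distribution of play is the time average, so the expected
  gain of a deviation is 1/T times its cumulative gain, which the regret bounds. The only delicate
  point is that the maximum in the regret is taken over an infinite set of linear maps: it is
  attained because a coarse trigger deviation maps pure strategies to 0/1 vectors, hence only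
  finitely many cumulative utilities occur.
*)
theory Submission
  imports Defs
begin

text \<open>Reading play as the law of \<open>\<pi>\<close> at a uniformly random time turns its
  expectation into a time average and its support into the set of played profiles.\<close>

lemma distribution_of_play_eq_map_pmf:
  assumes "T \<ge> 1"
  shows "distribution_of_play T \<pi> = map_pmf \<pi> (pmf_of_set {1..T})"
proof (rule pmf_eqI)
  fix p
  have "{1..T} \<inter> \<pi> -` {p} = {t \<in> {1..T}. \<pi> t = p}"
    by blast
  with assms show "pmf (distribution_of_play T \<pi>) p = pmf (map_pmf \<pi> (pmf_of_set {1..T})) p"
    by (simp add: pmf_distribution_of_play pmf_map measure_pmf_of_set)
qed

lemma expectation_distribution_of_play:
  fixes f :: "'p \<Rightarrow> real"
  assumes "T \<ge> 1"
  shows "measure_pmf.expectation (distribution_of_play T \<pi>) f = (\<Sum>t=1..T. f (\<pi> t)) / real T"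
  using assms by (simp add: distribution_of_play_eq_map_pmf integral_pmf_of_set)

lemma set_pmf_distribution_of_play:
  assumes "T \<ge> 1"
  shows "set_pmf (distribution_of_play T \<pi>) = \<pi> ` {1..T}"
  using assms by (simp add: distribution_of_play_eq_map_pmf set_pmf_of_set)

lemma finite_sequences:
  assumes G: "extensive_form_game G" and i: "i \<in> players G"
  shows "finite (sequences G i)"
proof -
  have "finite (nodes G)"
    using G by (simp add: extensive_form_game_def)
  then have "finite (decision_nodes G i)"
    by (rule rev_finite_subset) (auto simp: decision_nodes_def)
  then have "finite (infosets G i)"
    using infosets_partition[OF G i] by (rule finite_elements)
  then have "finite (SIGMA j:infosets G i. infoset_actions G j)"
    using finite_infoset_actions[OF G] by blast
  moreover have "sequences G i = Some ` (SIGMA j:infosets G i. infoset_actions G j) \<union> {None}"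
    by (auto simp: sequences_def)
  ultimately show ?thesis
    by simp
qed

text \<open>Members of \<open>vectors S\<close> vanish off \<open>S\<close>, so a binary one is the
  indicator of the subset of \<open>S\<close> where it equals 1, and \<open>Pow S\<close> is
  finite.\<close>

lemma finite_binary_vectors:
  assumes "finite S"
  shows "finite {x \<in> vectors S. \<forall>s\<in>S. x s \<in> {0, 1}}"
proof (rule finite_subset)
  show "{x \<in> vectors S. \<forall>s\<in>S. x s \<in> {0, 1}} \<subseteq> (\<lambda>A s. if s \<in> A then 1 else 0) ` Pow S"
  proof
    fix x
    assume "x \<in> {x \<in> vectors S. \<forall>s\<in>S. x s \<in> {0, 1}}"
    then have "x = (\<lambda>s. if s \<in> {s \<in> S. x s = 1} then 1 else 0)"
      by (auto simp: vectors_def fun_eq_iff)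
    then show "x \<in> (\<lambda>A s. if s \<in> A then 1 else 0) ` Pow S"
      by (rule image_eqI) blast
  qed
  show "finite ((\<lambda>A s. if s \<in> A then 1 else 0 :: real) ` Pow S)"
    using assms by simp
qed

text \<open>On a pure strategy one of the two defining clauses applies: the image is either
  \<open>p\<close> itself or \<open>p\<close> with the binary \<open>q\<close> pasted in below
  \<open>j\<close>.\<close>

lemma coarse_trigger_deviation_binary:
  assumes \<phi>: "\<phi> \<in> coarse_trigger_deviations G i" and p: "p \<in> pure_strategies G i"
  shows "\<phi> p \<in> {x \<in> vectors (sequences G i). \<forall>\<sigma>\<in>sequences G i. x \<sigma> \<in> {0, 1}}"
proof -
  obtain j q where q: "q \<in> pure_strategies_from G i j" and d: "coarse_trigger_deviation G i j q \<phi>"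
    using \<phi> by (auto simp: coarse_trigger_deviations_def)
  have p_vec: "p \<in> vectors (sequences G i)" and p_bin: "\<forall>\<sigma>\<in>sequences G i. p \<sigma> \<in> {0, 1}"
    using p by (auto simp: pure_strategies_def strategies_def)
  have "\<phi> p \<in> vectors (sequences G i)"
    using d p_vec by (auto simp: coarse_trigger_deviation_def linear_on_vectors_def)
  moreover have "\<phi> p \<sigma> \<in> {0, 1}" if \<sigma>: "\<sigma> \<in> sequences G i" for \<sigma>
  proof -
    have q_bin: "q \<sigma> \<in> {0, 1}" if "seq_geq \<sigma> j"
      using q \<sigma> that by (auto simp: pure_strategies_from_def sequences_from_def)
    \<comment> \<open>The case split avoids showing that the parent sequence lies in
      \<open>sequences G i\<close>: outside that set, \<open>p\<close> has the default value
      0.\<close>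
    have "p (parent_seq G i j) \<in> {0, 1}"
      using p_vec p_bin by (cases "parent_seq G i j \<in> sequences G i") (auto simp: vectors_def)
    then consider "\<phi> p = p" | "\<phi> p \<sigma> = (if seq_geq \<sigma> j then q \<sigma> else p \<sigma>)"
      using d p \<sigma> unfolding coarse_trigger_deviation_def by blast
    then show ?thesis
      using p_bin q_bin \<sigma> by cases auto
  qed
  ultimately show ?thesis
    by blast
qed

text \<open>The sum depends on \<open>\<phi>\<close> only through the tuple of images
  \<open>\<phi> (x t)\<close>, which ranges over a finite power of the set of binary vectors,
  whatever the functions \<open>l t\<close> are.\<close>

lemma finite_deviation_values:
  fixes l :: "nat \<Rightarrow> ('a seq \<Rightarrow> real) \<Rightarrow> real"
  assumes "extensive_form_game G" "i \<in> players G"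
    and x: "\<And>t. t \<in> {1..T} \<Longrightarrow> x t \<in> pure_strategies G i"
  shows "finite ((\<lambda>\<phi>. \<Sum>t=1..T. l t (\<phi> (x t))) ` coarse_trigger_deviations G i)"
proof (rule finite_subset)
  define B where "B = {x \<in> vectors (sequences G i). \<forall>\<sigma>\<in>sequences G i. x \<sigma> \<in> {0, 1}}"
  show "(\<lambda>\<phi>. \<Sum>t=1..T. l t (\<phi> (x t))) ` coarse_trigger_deviations G i
      \<subseteq> (\<lambda>y. \<Sum>t=1..T. l t (y t)) ` (\<Pi>\<^sub>E t\<in>{1..T}. B)"
  proof (rule image_subsetI)
    fix \<phi>
    assume "\<phi> \<in> coarse_trigger_deviations G i"
    \<comment> \<open>Restricting to \<open>{1..T}\<close> makes the tuple extensional, as the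
      product requires; the sum only looks at these times.\<close>
    then have "(\<lambda>t\<in>{1..T}. \<phi> (x t)) \<in> (\<Pi>\<^sub>E t\<in>{1..T}. B)"
      using coarse_trigger_deviation_binary[OF _ x] by (simp add: B_def)
    then show "(\<Sum>t=1..T. l t (\<phi> (x t))) \<in> (\<lambda>y. \<Sum>t=1..T. l t (y t)) ` (\<Pi>\<^sub>E t\<in>{1..T}. B)"
      by (rule rev_image_eqI) simp
  qed
  have "finite B"
    unfolding B_def by (rule finite_binary_vectors[OF finite_sequences[OF assms(1,2)]])
  then show "finite ((\<lambda>y. \<Sum>t=1..T. l t (y t)) ` (\<Pi>\<^sub>E t\<in>{1..T}. B))"
    by (intro finite_imageI finite_PiE) simp_all
qed

theorem theorem2p11:
  fixes G :: "'a game" and T :: nat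
    and \<pi> :: "nat \<Rightarrow> nat \<Rightarrow> 'a seq \<Rightarrow> real" and Reg :: "nat \<Rightarrow> real"
  assumes "extensive_form_game G" and "perfect_recall G"
    and "T \<ge> 1"
    and "\<And>t. t \<in> {1..T} \<Longrightarrow> \<pi> t \<in> pure_profiles G"
    and "\<And>i. i \<in> players G \<Longrightarrow> coarse_trigger_deviations G i \<noteq> {} \<Longrightarrow>
           deviation_regret (coarse_trigger_deviations G i) T
             (\<lambda>t x. utility G i ((\<pi> t)(i := x))) (\<lambda>t. \<pi> t i) \<le> Reg i"
  shows "approx_EFCCE G (1 / real T * Max (Reg ` players G)) (distribution_of_play T \<pi>)"
  unfolding approx_EFCCE_def
proof (intro conjI ballI)
  show "set_pmf (distribution_of_play T \<pi>) \<subseteq> pure_profiles G"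
    using assms(3,4) by (auto simp: set_pmf_distribution_of_play)
next
  fix i \<phi>
  assume i: "i \<in> players G" and \<phi>: "\<phi> \<in> coarse_trigger_deviations G i"
  let ?val = "\<lambda>\<phi>. \<Sum>t=1..T. utility G i ((\<pi> t)(i := \<phi> (\<pi> t i)))"
  have "\<pi> t i \<in> pure_strategies G i" if "t \<in> {1..T}" for t
    using assms(4)[OF that] i by (auto simp: pure_profiles_def)
  then have "finite (?val ` coarse_trigger_deviations G i)"
    by (rule finite_deviation_values[OF assms(1) i])
  \<comment> \<open>Finiteness is essential here: only then does \<open>Max\<close> bound every
    attained value.\<close>
  then have "?val \<phi> \<le> Max (?val ` coarse_trigger_deviations G i)"
    using \<phi> by (intro Max_ge imageI)
  \<comment> \<open>The deviation \<open>\<phi>\<close> witnesses that the set is nonempty, so the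
    regret bound applies; updating \<open>\<pi> t\<close> at \<open>i\<close> by its own entry gives
    back \<open>\<pi> t\<close>.\<close>
  moreover have "Max (?val ` coarse_trigger_deviations G i) - (\<Sum>t=1..T. utility G i (\<pi> t)) \<le> Reg i"
    using assms(5)[OF i] \<phi> by (auto simp: deviation_regret_def)
  moreover have "Reg i \<le> Max (Reg ` players G)"
    using i by (intro Max_ge imageI) (simp_all add: players_def)
  ultimately have "?val \<phi> - (\<Sum>t=1..T. utility G i (\<pi> t)) \<le> Max (Reg ` players G)"
    by linarith
  then show "measure_pmf.expectation (distribution_of_play T \<pi>)
      (\<lambda>\<pi>. utility G i (\<pi>(i := \<phi> (\<pi> i))) - utility G i \<pi>) \<le> 1 / real T * Max (Reg ` players G)"
    using assms(3) by (simp add: expectation_distribution_of_play sum_subtractf divide_right_mono)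
qed

end
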